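(* Let $(a(t);\lambda(t))$, with $a=(a_{ij})_{1\le i,j\le2}\in\mathrm{SL}(2,\mathbb{R})$ and $\lambda=(\lambda_{ij})_{1\le i,j\le 2}$, be a solution of the Hamiltonian system $$\dot a_{ij}=\frac{\partial\mathscr{H}}{\partial\lambda_{ij}},\qquad \dot\lambda_{ij}=-\frac{\partial\mathscr{H}}{\partial a_{ij}},\qquad i,j\in\{1,2\},$$ for $$\mathscr{H}(a;\lambda)=a_{11}a_{12}\lambda_{11}\lambda_{12}+a_{11}a_{22}\lambda_{12}\lambda_{21}+a_{12}a_{21}\lambda_{11}\lambda_{22}+a_{21}a_{22}\lambda_{21}\lambda_{22}.$$ Put $M=a_{11}\lambda_{12}+a_{21}\lambda_{22}$ and $N=a_{12}\lambda_{11}+a_{22}\lambda_{21}$. Then the following five quantities are constant along the solution: $$C_1=a_{11}\lambda_{11}+a_{12}\lambda_{12},\quad C_2=a_{21}\lambda_{11}+a_{22}\lambda_{12},\quad C_3=a_{11}\lambda_{21}+a_{12}\lambda_{22},\quad C_4=a_{21}\lambda_{21}+a_{22}\lambda_{22},\quad C_5=MN.$$ Moreover, the trajectory $a(t)$ satisfies $$\begin{cases} \dot a_{11}=a_{12}\big((C_4-C_1)a_{11}a_{21}+C_2a_{11}^2-C_3a_{21}^2\big),\\ \dot a_{12}=a_{11}\big((C_1-C_4)a_{12}a_{22}-C_2a_{12}^2+C_3a_{22}^2\big),\\ \dot a_{21}=a_{22}\big((C_4-C_1)a_{11}a_{21}+C_2a_{11}^2-C_3a_{21}^2\big),\\ \dot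 a_{22}=a_{21}\big((C_1-C_4)a_{12}a_{22}-C_2a_{12}^2+C_3a_{22}^2\big). \end{cases}$$
   Context: $\mathscr{H}$ is the metric quadratic Hamiltonian on $T^*\mathrm{SL}(2,\mathbb{R})$, written in the Euclidean coordinates $a_{ij}$ of $\mathbb{R}^{2\times2}\supset\mathrm{SL}(2,\mathbb{R})$ and their dual cotangent coordinates $\lambda_{ij}$. *)

theory Defs
  imports "HOL-Analysis.Analysis"
begin

definition SL2 :: "(real^2^2) set" where
  "SL2 = {A. det A = 1}"

definition entry_partial :: "(real^2^2 \<Rightarrow> real) \<Rightarrow> 2 \<Rightarrow> 2 \<Rightarrow> real^2^2 \<Rightarrow> real" where
  "entry_partial F i j X =
     deriv (\<lambda>s. F (\<chi> k l. if k = i \<and> l = j then s else X $ k $ l)) (X $ i $ j)"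

text \<open>
  Curves are given on a set \<open>T\<close> of times, meant to be an interval of any kind; at an endpoint
  belonging to \<open>T\<close> the derivative is one-sided. The second argument of the Hamiltonian and
  the curve \<open>p\<close> are the dual coordinates, written \<open>\<lambda>\<close> in the mathematical
  notation. The Hamiltonian is a function on the ambient space
  \<open>T\<^sup>*\<real>\<^sup>2\<^sup>\<times>\<^sup>2\<close>, so its partial derivatives are those in the
  eight independent coordinates.
\<close>

definition hamiltonian_solution ::
  "(real^2^2 \<Rightarrow> real^2^2 \<Rightarrow> real) \<Rightarrow> real set \<Rightarrow> (real \<Rightarrow> real^2^2) \<Rightarrow> (real \<Rightarrow> real^2^2) \<Rightarrow> bool" where
  "hamiltonian_solution H T a p \<longleftrightarrow>
     (\<forall>t\<in>T. \<forall>i j.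
        ((\<lambda>s. a s $ i $ j) has_real_derivative entry_partial (\<lambda>P. H (a t) P) i j (p t)) (at t within T) \<and>
        ((\<lambda>s. p s $ i $ j) has_real_derivative - entry_partial (\<lambda>A. H A (p t)) i j (a t)) (at t within T))"

definition metric_ham :: "real^2^2 \<Rightarrow> real^2^2 \<Rightarrow> real" where
  "metric_ham a p =
     a$1$1 * a$1$2 * p$1$1 * p$1$2 + a$1$1 * a$2$2 * p$1$2 * p$2$1 +
     a$1$2 * a$2$1 * p$1$1 * p$2$2 + a$2$1 * a$2$2 * p$2$1 * p$2$2"

definition M_fun :: "real^2^2 \<Rightarrow> real^2^2 \<Rightarrow> real" where
  "M_fun a p = a$1$1 * p$1$2 + a$2$1 * p$2$2"

definition N_fun :: "real^2^2 \<Rightarrow> real^2^2 \<Rightarrow> real" where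
  "N_fun a p = a$1$2 * p$1$1 + a$2$2 * p$2$1"

end

theory Submission
  imports Defs
begin

text \<open>
  The Hamiltonian factors as \<open>M N\<close>. Along the flow the columns of \<open>a\<close> are therefore exchanged up to the
  factors \<open>M\<close> and \<open>N\<close>, and the columns of \<open>\<lambda>\<close> are exchanged up to \<open>- N\<close> and \<open>- M\<close>. Hence the
  entries of \<open>a \<lambda>\<^sup>T\<close> are constant, and \<open>M' = K M\<close>, \<open>N' = - K N\<close> for a common \<open>K\<close>. The
  trajectory equations arise by writing \<open>M\<close> and \<open>N\<close> in terms of \<open>a\<close> and the constants, using
  \<open>det a = 1\<close>.
\<close>

lemma one_neq_two [simp]: "(1::2) \<noteq> 2" "(2::2) \<noteq> 1"
  using exhaust_2 by auto

text \<open>In the product of \<open>M_fun\<close> and \<open>N_fun\<close>, the first column of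
  \<open>P\<close> occurs only in \<open>N_fun\<close> and the second only in \<open>M_fun\<close>,
  so each partial derivative leaves one factor untouched.\<close>

lemma entry_partial_metric_ham_momentum:
  "entry_partial (metric_ham A) 1 1 P = A$1$2 * M_fun A P"
  "entry_partial (metric_ham A) 1 2 P = A$1$1 * N_fun A P"
  "entry_partial (metric_ham A) 2 1 P = A$2$2 * M_fun A P"
  "entry_partial (metric_ham A) 2 2 P = A$2$1 * N_fun A P"
  unfolding entry_partial_def metric_ham_def M_fun_def N_fun_def
  by (rule DERIV_imp_deriv, auto intro!: derivative_eq_intros simp: algebra_simps)+

lemma entry_partial_metric_ham_position:
  "entry_partial (\<lambda>A. metric_ham A P) 1 1 A = P$1$2 * N_fun A P"
  "entry_partial (\<lambda>A. metric_ham A P) 1 2 A = P$1$1 * M_fun A P"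
  "entry_partial (\<lambda>A. metric_ham A P) 2 1 A = P$2$2 * N_fun A P"
  "entry_partial (\<lambda>A. metric_ham A P) 2 2 A = P$2$1 * M_fun A P"
  unfolding entry_partial_def metric_ham_def M_fun_def N_fun_def
  by (rule DERIV_imp_deriv, auto intro!: derivative_eq_intros simp: algebra_simps)+

text \<open>Put G = A P^T, whose entries are the four bracketed sums. Then P^T A = A^(-1) G A, and
  \<open>M_fun A P\<close> is its lower left entry: the row (-\<open>A$2$1\<close>,
  \<open>A$1$1\<close>) of A^(-1), times G, times the first column of A.\<close>

lemma M_fun_eq_on_SL2:
  assumes "A \<in> SL2"
  shows "M_fun A P =
    ((A$2$1 * P$2$1 + A$2$2 * P$2$2) - (A$1$1 * P$1$1 + A$1$2 * P$1$2)) * A$1$1 * A$2$1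
    + (A$2$1 * P$1$1 + A$2$2 * P$1$2) * (A$1$1)\<^sup>2
    - (A$1$1 * P$2$1 + A$1$2 * P$2$2) * (A$2$1)\<^sup>2"
proof -
  have "A$1$1 * A$2$2 - A$1$2 * A$2$1 = 1"
    using assms by (simp add: SL2_def det_2)
  \<comment> \<open>The factor det A = 1 turns the claim into a polynomial identity.\<close>
  then have "M_fun A P = M_fun A P * (A$1$1 * A$2$2 - A$1$2 * A$2$1)"
    by simp
  then show ?thesis
    by (simp add: M_fun_def power2_eq_square algebra_simps)
qed

text \<open>Likewise, \<open>N_fun A P\<close> is the upper right entry of A^(-1) G A with G = A
  P^T.\<close>

lemma N_fun_eq_on_SL2:
  assumes "A \<in> SL2"
  shows "N_fun A P =
    ((A$1$1 * P$1$1 + A$1$2 * P$1$2) - (A$2$1 * P$2$1 + A$2$2 * P$2$2)) * A$1$2 * A$2$2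
    - (A$2$1 * P$1$1 + A$2$2 * P$1$2) * (A$1$2)\<^sup>2
    + (A$1$1 * P$2$1 + A$1$2 * P$2$2) * (A$2$2)\<^sup>2"
proof -
  have "A$1$1 * A$2$2 - A$1$2 * A$2$1 = 1"
    using assms by (simp add: SL2_def det_2)
  then have "N_fun A P = N_fun A P * (A$1$1 * A$2$2 - A$1$2 * A$2$1)"
    by simp
  then show ?thesis
    by (simp add: N_fun_def power2_eq_square algebra_simps)
qed

text \<open>The constant is existential because \<open>T\<close> may be empty and then offers no
  base point.\<close>

lemma constant_if_derivative_zero:
  fixes f :: "real \<Rightarrow> real"
  assumes "is_interval T" "\<And>t. t \<in> T \<Longrightarrow> (f has_real_derivative 0) (at t within T)"
  shows "\<exists>c. \<forall>t\<in>T. f t = c"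
  using has_field_derivative_zero_constant[of T f] assms is_interval_convex by blast

theorem mainTheorem4:
  fixes T :: "real set" and a p :: "real \<Rightarrow> real^2^2"
  assumes "is_interval T"
    and "\<And>t. t \<in> T \<Longrightarrow> a t \<in> SL2"
    and "hamiltonian_solution metric_ham T a p"
  shows "\<exists>C1 C2 C3 C4 C5 :: real.
    (\<forall>t\<in>T.
       a t$1$1 * p t$1$1 + a t$1$2 * p t$1$2 = C1 \<and>
       a t$2$1 * p t$1$1 + a t$2$2 * p t$1$2 = C2 \<and>
       a t$1$1 * p t$2$1 + a t$1$2 * p t$2$2 = C3 \<and>
       a t$2$1 * p t$2$1 + a t$2$2 * p t$2$2 = C4 \<and>
       M_fun (a t) (p t) * N_fun (a t) (p t) = C5) \<and>
    (\<forall>t\<in>T.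
       ((\<lambda>s. a s$1$1) has_real_derivative
          a t$1$2 * ((C4 - C1) * a t$1$1 * a t$2$1 + C2 * (a t$1$1)\<^sup>2 - C3 * (a t$2$1)\<^sup>2)) (at t within T) \<and>
       ((\<lambda>s. a s$1$2) has_real_derivative
          a t$1$1 * ((C1 - C4) * a t$1$2 * a t$2$2 - C2 * (a t$1$2)\<^sup>2 + C3 * (a t$2$2)\<^sup>2)) (at t within T) \<and>
       ((\<lambda>s. a s$2$1) has_real_derivative
          a t$2$2 * ((C4 - C1) * a t$1$1 * a t$2$1 + C2 * (a t$1$1)\<^sup>2 - C3 * (a t$2$1)\<^sup>2)) (at t within T) \<and>
       ((\<lambda>s. a s$2$2) has_real_derivative
          a t$2$1 * ((C1 - C4) * a t$1$2 * a t$2$2 - C2 * (a t$1$2)\<^sup>2 + C3 * (a t$2$2)\<^sup>2)) (at t within T))"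
proof -
  have da: "((\<lambda>s. a s$1$1) has_real_derivative a t$1$2 * M_fun (a t) (p t)) (at t within T)"
      "((\<lambda>s. a s$1$2) has_real_derivative a t$1$1 * N_fun (a t) (p t)) (at t within T)"
      "((\<lambda>s. a s$2$1) has_real_derivative a t$2$2 * M_fun (a t) (p t)) (at t within T)"
      "((\<lambda>s. a s$2$2) has_real_derivative a t$2$1 * N_fun (a t) (p t)) (at t within T)"
    and dp: "((\<lambda>s. p s$1$1) has_real_derivative - (p t$1$2 * N_fun (a t) (p t))) (at t within T)"
      "((\<lambda>s. p s$1$2) has_real_derivative - (p t$1$1 * M_fun (a t) (p t))) (at t within T)"
      "((\<lambda>s. p s$2$1) has_real_derivative - (p t$2$2 * N_fun (a t) (p t))) (at t within T)"
      "((\<lambda>s. p s$2$2) has_real_derivative - (p t$2$1 * M_fun (a t) (p t))) (at t within T)"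
    if "t \<in> T" for t
    using assms(3)[unfolded hamiltonian_solution_def, rule_format, OF that, of 1 1]
      assms(3)[unfolded hamiltonian_solution_def, rule_format, OF that, of 1 2]
      assms(3)[unfolded hamiltonian_solution_def, rule_format, OF that, of 2 1]
      assms(3)[unfolded hamiltonian_solution_def, rule_format, OF that, of 2 2]
    by (simp_all add: entry_partial_metric_ham_momentum entry_partial_metric_ham_position)
  note d = da dp
  \<comment> \<open>\<open>K\<close> is the difference of the diagonal entries of p^T a, lower minus
    upper. It is what remains when \<open>M_fun\<close> is factored out of its own
    derivative.\<close>
  define K where
    "K t = a t$1$2 * p t$1$2 - a t$1$1 * p t$1$1 + a t$2$2 * p t$2$2 - a t$2$1 * p t$2$1" for t
  have dM: "((\<lambda>s. M_fun (a s) (p s)) has_real_derivative K t * M_fun (a t) (p t)) (at t within T)"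
    if "t \<in> T" for t
    unfolding M_fun_def[of "a _" "p _", abs_def]
    by (rule derivative_eq_intros d that refl)+ (simp add: K_def M_fun_def algebra_simps)
  have dN: "((\<lambda>s. N_fun (a s) (p s)) has_real_derivative - K t * N_fun (a t) (p t)) (at t within T)"
    if "t \<in> T" for t
    unfolding N_fun_def[of "a _" "p _", abs_def]
    by (rule derivative_eq_intros d that refl)+ (simp add: K_def N_fun_def algebra_simps)
  \<comment> \<open>In the derivative of each entry of a p^T the terms cancel in pairs:
    differentiating a first-column entry of a and a second-column entry of p gives opposite
    multiples of \<open>M_fun\<close>, and the other two columns do so with
    \<open>N_fun\<close>.\<close>
  have "\<exists>c. \<forall>t\<in>T. a t$1$1 * p t$1$1 + a t$1$2 * p t$1$2 = c"
    by (rule constant_if_derivative_zero[OF assms(1)])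
      ((rule derivative_eq_intros d refl | assumption)+, simp add: algebra_simps)
  then obtain C1 where C1: "\<And>t. t \<in> T \<Longrightarrow> a t$1$1 * p t$1$1 + a t$1$2 * p t$1$2 = C1"
    by blast
  have "\<exists>c. \<forall>t\<in>T. a t$2$1 * p t$1$1 + a t$2$2 * p t$1$2 = c"
    by (rule constant_if_derivative_zero[OF assms(1)])
      ((rule derivative_eq_intros d refl | assumption)+, simp add: algebra_simps)
  then obtain C2 where C2: "\<And>t. t \<in> T \<Longrightarrow> a t$2$1 * p t$1$1 + a t$2$2 * p t$1$2 = C2"
    by blast
  have "\<exists>c. \<forall>t\<in>T. a t$1$1 * p t$2$1 + a t$1$2 * p t$2$2 = c"
    by (rule constant_if_derivative_zero[OF assms(1)])
      ((rule derivative_eq_intros d refl | assumption)+, simp add: algebra_simps)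
  then obtain C3 where C3: "\<And>t. t \<in> T \<Longrightarrow> a t$1$1 * p t$2$1 + a t$1$2 * p t$2$2 = C3"
    by blast
  have "\<exists>c. \<forall>t\<in>T. a t$2$1 * p t$2$1 + a t$2$2 * p t$2$2 = c"
    by (rule constant_if_derivative_zero[OF assms(1)])
      ((rule derivative_eq_intros d refl | assumption)+, simp add: algebra_simps)
  then obtain C4 where C4: "\<And>t. t \<in> T \<Longrightarrow> a t$2$1 * p t$2$1 + a t$2$2 * p t$2$2 = C4"
    by blast
  \<comment> \<open>The logarithmic rates \<open>K\<close> and -\<open>K\<close> cancel; this is
    conservation of the Hamiltonian.\<close>
  have "\<exists>c. \<forall>t\<in>T. M_fun (a t) (p t) * N_fun (a t) (p t) = c"
    by (rule constant_if_derivative_zero[OF assms(1)])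
      ((rule derivative_eq_intros dM dN refl | assumption)+, simp add: algebra_simps)
  then obtain C5 where C5: "\<And>t. t \<in> T \<Longrightarrow> M_fun (a t) (p t) * N_fun (a t) (p t) = C5"
    by blast
  have M: "M_fun (a t) (p t) =
      (C4 - C1) * a t$1$1 * a t$2$1 + C2 * (a t$1$1)\<^sup>2 - C3 * (a t$2$1)\<^sup>2" if "t \<in> T" for t
    using M_fun_eq_on_SL2[OF assms(2)[OF that], of "p t"] C1 C2 C3 C4 that by simp
  have N: "N_fun (a t) (p t) =
      (C1 - C4) * a t$1$2 * a t$2$2 - C2 * (a t$1$2)\<^sup>2 + C3 * (a t$2$2)\<^sup>2" if "t \<in> T" for t
    using N_fun_eq_on_SL2[OF assms(2)[OF that], of "p t"] C1 C2 C3 C4 that by simp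
  \<comment> \<open>Folding the polynomials back into \<open>M_fun\<close> and \<open>N_fun\<close>
    reduces the trajectory equations to \<open>da\<close>.\<close>
  show ?thesis
    by (intro exI[of _ C1] exI[of _ C2] exI[of _ C3] exI[of _ C4] exI[of _ C5] conjI ballI)
      (simp_all add: C1 C2 C3 C4 C5 d M[symmetric] N[symmetric])
qed

end
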